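(* If $t \to_{n}^{(m,e)} p$ with $p \in \mathsf{no}_n$, then there exist a context $\Gamma$ and a type $\sigma$ and a tight derivation in system $\mathcal{N}$ of $\Gamma \vdash^{(m,e,|p|_n)} t : \sigma$.
   Context: Terms. Fix a countably infinite set of variables. Terms are $t,u,r ::= x \mid \lambda x.t \mid t\,u \mid t[x\backslash u]$, where $t[x\backslash u]$ (an explicit substitution) binds $x$ in $t$; terms are taken modulo $\alpha$-conversion and $t\{x:=u\}$ denotes capture-avoiding meta-level substitution. List contexts are $L ::= \square \mid L[x\backslash t]$, and $L\langle t\rangle$ is the result of plugging $t$ into the hole. CBN neutral and normal terms: $\mathsf{ne}_n ::= x \mid \mathsf{ne}_n\, t$ and $\mathsf{no}_n ::= \lambda x.\mathsf{no}_n \mid \mathsf{ne}_n$. The $n$-size is $|x|_n=0$, $|\lambda x.t|_n = |t|_n+1$, $|t\,u|_n = |t|_n+1$, $|t[x\backslash u]|_n = |t|_n$. Reduction. Rule $\mathtt{dB}$: $(L\langle \lambda x.t\rangle)\,u \mapsto L\langle t[x\backslash u]\rangle$; rule $\mathtt{sn}$: $t[x\backslash u] \mapsto t\{x:=u\}$. CBN contexts are $N ::= \square \mid N\,t \mid \lambda x.N \mid N[x\backslash u]$, and $\to_n$ is the closure of $\mathtt{dB}\cup\mathtt{sn}$ under CBN contexts. $\mathtt{dB}$-steps are multiplicative ($m$-steps), $\mathtt{sn}$-steps are exponential ($e$-steps). $t \to_n^{(m,e)} p$ means $t$ reduces to $p$ in finitely many $\to_n$ steps, exactly $m$ of which are $m$-steps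 and $e$ of which are $e$-steps. Types. Tight types: $\mathtt{tt} ::= \mathtt{n} \mid \mathtt{a}$. Types: $\sigma,\tau ::= \mathtt{tt} \mid \mathcal{M} \mid \mathcal{M}\to\sigma$, where multitypes $\mathcal{M} = [\sigma_i]_{i\in I}$ are finite multisets of types ($[\,]$ empty, $\sqcup$ union). A typing context $\Gamma$ maps variables to multitypes, $[\,]$ for all but finitely many; $\mathrm{dom}(\Gamma)=\{x \mid \Gamma(x)\neq[\,]\}$; $(\Gamma+\Delta)(x) = \Gamma(x)\sqcup\Delta(x)$, extended to finite sums $+_{i\in I}\Gamma_i$ (the empty context if $I=\emptyset$); $\Gamma\setminus\!\!\setminus x$ maps $x$ to $[\,]$ and agrees with $\Gamma$ elsewhere; $\Gamma; x:\mathcal{M}$ is the context mapping $x$ to $\mathcal{M}$ and agreeing with $\Gamma$ elsewhere, where $x\notin\mathrm{dom}(\Gamma)$. Judgements $\Gamma \vdash^{(m,e,s)} t:\sigma$ carry natural-number counters. System $\mathcal{N}$ consists of the rules: (app$_p$) from $\Gamma\vdash^{(m,e,s)} t:\mathtt{n}$ infer $\Gamma\vdash^{(m,e,s+1)} t\,u:\mathtt{n}$; (abs$_p$) from $\Gamma\vdash^{(m,e,s)} t:\mathtt{tt}$ (a tight type) with $\Gamma(x)$ tight, infer $\Gamma\setminus\!\!\setminus x\vdash^{(m,e,s+1)}\lambda x.t:\mathtt{a}$; (var$_c$) $x:[\sigma]\vdash^{(0,0,0)} x:\sigma$; (abs$_c$) from $\Gamma\vdash^{(m,e,s)} t:\tau$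 infer $\Gamma\setminus\!\!\setminus x\vdash^{(m,e,s)}\lambda x.t:\Gamma(x)\to\tau$; (app$_c$) from $\Gamma\vdash^{(m,e,s)} t:[\sigma_i]_{i\in I}\to\tau$ and $\Delta_i\vdash^{(m_i,e_i,s_i)} u:\sigma_i$ for each $i\in I$, infer $\Gamma+_{i\in I}\Delta_i\vdash^{(1+m+\sum_i m_i,\,1+e+\sum_i e_i,\,s+\sum_i s_i)} t\,u:\tau$; (es$_c$) from $\Gamma;x:[\sigma_i]_{i\in I}\vdash^{(m,e,s)} t:\tau$ and $\Delta_i\vdash^{(m_i,e_i,s_i)} u:\sigma_i$ for each $i\in I$, infer $(\Gamma\setminus\!\!\setminus x)+_{i\in I}\Delta_i\vdash^{(m+\sum_i m_i,\,1+e+\sum_i e_i,\,s+\sum_i s_i)} t[x\backslash u]:\tau$. A multitype is tight if all its elements are tight types; a context is tight if all multitypes it assigns are tight; a derivation of $\Gamma\vdash^{(m,e,s)} t:\sigma$ is tight if $\Gamma$ is tight and $\sigma$ is a tight type. *)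

theory Defs
  imports Main "HOL-Library.Multiset"
begin

text \<open>
  Terms modulo \<open>\<alpha>\<close>-conversion are represented with de Bruijn indices; an index that points
  past all enclosing binders is a free variable, so the countably many free variables are the
  natural numbers. \<open>ES t u\<close> is the explicit substitution \<open>t[x\u]\<close>: it binds index 0 in
  \<open>t\<close> and binds nothing in \<open>u\<close>.
\<close>

datatype trm =
    Var nat
  | Lam trm
  | App trm trm
  | ES trm trm

text \<open>\<open>lift k c t\<close> adds \<open>k\<close> to every variable of \<open>t\<close> whose index is at least \<open>c\<close>.\<close>

primrec lift :: "nat \<Rightarrow> nat \<Rightarrow> trm \<Rightarrow> trm" where
  "lift k c (Var i) = (if i < c then Var i else Var (i + k))"
| "lift k c (Lam t) = Lam (lift k (Suc c) t)"
| "lift k c (App t u) = App (lift k c t) (lift k c u)"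
| "lift k c (ES t u) = ES (lift k (Suc c) t) (lift k c u)"

text \<open>
  \<open>subst t j u\<close> replaces variable \<open>j\<close> of \<open>t\<close> by \<open>u\<close> and removes \<open>j\<close> from the scope, so larger
  indices decrease by one. With \<open>j = 0\<close> this is the contraction \<open>t{x:=u}\<close> of a binder of \<open>x\<close>
  around \<open>t\<close>.
\<close>

primrec subst :: "trm \<Rightarrow> nat \<Rightarrow> trm \<Rightarrow> trm" where
  "subst (Var i) j u = (if i < j then Var i else if i = j then u else Var (i - 1))"
| "subst (Lam t) j u = Lam (subst t (Suc j) (lift 1 0 u))"
| "subst (App t r) j u = App (subst t j u) (subst r j u)"
| "subst (ES t r) j u = ES (subst t (Suc j) (lift 1 0 u)) (subst r j u)"

datatype lctx =
    LHole
  | LES lctx trm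

primrec lplug :: "lctx \<Rightarrow> trm \<Rightarrow> trm" where
  "lplug LHole t = t"
| "lplug (LES L u) t = ES (lplug L t) u"

text \<open>The number of binders of a list context that enclose its hole.\<close>

primrec ldepth :: "lctx \<Rightarrow> nat" where
  "ldepth LHole = 0"
| "ldepth (LES L u) = Suc (ldepth L)"

inductive ne_n :: "trm \<Rightarrow> bool" where
  ne_var: "ne_n (Var x)"
| ne_app: "ne_n t \<Longrightarrow> ne_n (App t u)"

inductive no_n :: "trm \<Rightarrow> bool" where
  no_lam: "no_n t \<Longrightarrow> no_n (Lam t)"
| no_ne: "ne_n t \<Longrightarrow> no_n t"

primrec nsize :: "trm \<Rightarrow> nat" where
  "nsize (Var x) = 0"
| "nsize (Lam t) = nsize t + 1"
| "nsize (App t u) = nsize t + 1"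
| "nsize (ES t u) = nsize t"

text \<open>
  In \<open>dB\<close> the argument \<open>u\<close> moves below the binders of \<open>L\<close>; lifting it is the counterpart of
  the convention that \<open>L\<close> binds no free variable of \<open>u\<close>.
\<close>

inductive dB :: "trm \<Rightarrow> trm \<Rightarrow> bool" where
  dB: "dB (App (lplug L (Lam t)) u) (lplug L (ES t (lift (ldepth L) 0 u)))"

inductive sn :: "trm \<Rightarrow> trm \<Rightarrow> bool" where
  sn: "sn (ES t u) (subst t 0 u)"

datatype nctx =
    NHole
  | NApp nctx trm
  | NLam nctx
  | NES nctx trm

primrec nplug :: "nctx \<Rightarrow> trm \<Rightarrow> trm" where
  "nplug NHole t = t"
| "nplug (NApp N u) t = App (nplug N t) u"
| "nplug (NLam N) t = Lam (nplug N t)"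
| "nplug (NES N u) t = ES (nplug N t) u"

inductive n_closure :: "(trm \<Rightarrow> trm \<Rightarrow> bool) \<Rightarrow> trm \<Rightarrow> trm \<Rightarrow> bool"
  for R :: "trm \<Rightarrow> trm \<Rightarrow> bool" where
  n_closure: "R t t' \<Longrightarrow> n_closure R (nplug N t) (nplug N t')"

abbreviation mstep :: "trm \<Rightarrow> trm \<Rightarrow> bool" where
  "mstep \<equiv> n_closure dB"

abbreviation estep :: "trm \<Rightarrow> trm \<Rightarrow> bool" where
  "estep \<equiv> n_closure sn"

inductive n_reduces :: "nat \<Rightarrow> nat \<Rightarrow> trm \<Rightarrow> trm \<Rightarrow> bool" where
  n_refl: "n_reduces 0 0 t t"
| n_mstep: "mstep t t' \<Longrightarrow> n_reduces m e t' p \<Longrightarrow> n_reduces (Suc m) e t p"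
| n_estep: "estep t t' \<Longrightarrow> n_reduces m e t' p \<Longrightarrow> n_reduces m (Suc e) t p"

datatype tight_ty = TN | TA

datatype ty =
    Tight tight_ty
  | Multi "ty multiset"
  | Arrow "ty multiset" ty

type_synonym multitype = "ty multiset"

text \<open>
  Contexts are total functions on variables; \<open>typing_context\<close> is the finite-domain
  requirement. The rules below only derive judgements with such contexts (lemma
  \<open>derivN_typing_context\<close>).
\<close>

type_synonym ctx = "nat \<Rightarrow> multitype"

definition ctx_dom :: "ctx \<Rightarrow> nat set" where
  "ctx_dom \<Gamma> = {x. \<Gamma> x \<noteq> {#}}"

definition typing_context :: "ctx \<Rightarrow> bool" where
  "typing_context \<Gamma> \<longleftrightarrow> finite (ctx_dom \<Gamma>)"

definition ctx_single :: "nat \<Rightarrow> multitype \<Rightarrow> ctx" where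
  "ctx_single x M = (\<lambda>y. if y = x then M else {#})"

definition ctx_add :: "ctx \<Rightarrow> ctx \<Rightarrow> ctx" where
  "ctx_add \<Gamma> \<Delta> = (\<lambda>x. \<Gamma> x + \<Delta> x)"

definition ctx_sum :: "nat set \<Rightarrow> (nat \<Rightarrow> ctx) \<Rightarrow> ctx" where
  "ctx_sum I \<Delta> = (\<lambda>x. \<Sum>i\<in>I. \<Delta> i x)"

text \<open>
  For a context \<open>\<Gamma>\<close> of a term below a binder of \<open>x\<close> (index 0), \<open>ctx_pop \<Gamma>\<close> is \<open>\<Gamma>\<close> without
  \<open>x\<close>, re-indexed for use outside the binder.
\<close>

definition ctx_pop :: "ctx \<Rightarrow> ctx" where
  "ctx_pop \<Gamma> = (\<lambda>x. \<Gamma> (Suc x))"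

definition family :: "nat set \<Rightarrow> (nat \<Rightarrow> ty) \<Rightarrow> multitype" where
  "family I \<sigma> = image_mset \<sigma> (mset_set I)"

definition tight_type :: "ty \<Rightarrow> bool" where
  "tight_type \<sigma> \<longleftrightarrow> (\<exists>tt. \<sigma> = Tight tt)"

definition tight_multitype :: "multitype \<Rightarrow> bool" where
  "tight_multitype M \<longleftrightarrow> (\<forall>\<sigma>\<in>#M. tight_type \<sigma>)"

definition tight_context :: "ctx \<Rightarrow> bool" where
  "tight_context \<Gamma> \<longleftrightarrow> (\<forall>x. tight_multitype (\<Gamma> x))"

text \<open>
  \<open>derivN \<Gamma> m e s t \<sigma>\<close> is the judgement \<open>\<Gamma> \<turnstile>\<^sup>(m,e,s) t : \<sigma>\<close>. In \<open>es_c\<close> the context of the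
  body is \<open>\<Gamma>; x : family I \<sigma>\<close>, where index 0 plays the role of \<open>x\<close>.
\<close>

inductive derivN :: "ctx \<Rightarrow> nat \<Rightarrow> nat \<Rightarrow> nat \<Rightarrow> trm \<Rightarrow> ty \<Rightarrow> bool" where
  app_p: "derivN \<Gamma> m e s t (Tight TN) \<Longrightarrow> derivN \<Gamma> m e (s + 1) (App t u) (Tight TN)"
| abs_p: "derivN \<Gamma> m e s t (Tight tt) \<Longrightarrow> tight_multitype (\<Gamma> 0) \<Longrightarrow>
    derivN (ctx_pop \<Gamma>) m e (s + 1) (Lam t) (Tight TA)"
| var_c: "derivN (ctx_single x {#\<sigma>#}) 0 0 0 (Var x) \<sigma>"
| abs_c: "derivN \<Gamma> m e s t \<tau> \<Longrightarrow> derivN (ctx_pop \<Gamma>) m e s (Lam t) (Arrow (\<Gamma> 0) \<tau>)"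
| app_c: "finite I \<Longrightarrow> derivN \<Gamma> m e s t (Arrow (family I \<sigma>) \<tau>) \<Longrightarrow>
    (\<And>i. i \<in> I \<Longrightarrow> derivN (\<Delta> i) (mi i) (ei i) (si i) u (\<sigma> i)) \<Longrightarrow>
    derivN (ctx_add \<Gamma> (ctx_sum I \<Delta>))
      (1 + m + (\<Sum>i\<in>I. mi i)) (1 + e + (\<Sum>i\<in>I. ei i)) (s + (\<Sum>i\<in>I. si i)) (App t u) \<tau>"
| es_c: "finite I \<Longrightarrow> derivN \<Gamma> m e s t \<tau> \<Longrightarrow> \<Gamma> 0 = family I \<sigma> \<Longrightarrow>
    (\<And>i. i \<in> I \<Longrightarrow> derivN (\<Delta> i) (mi i) (ei i) (si i) u (\<sigma> i)) \<Longrightarrow>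
    derivN (ctx_add (ctx_pop \<Gamma>) (ctx_sum I \<Delta>))
      (m + (\<Sum>i\<in>I. mi i)) (1 + e + (\<Sum>i\<in>I. ei i)) (s + (\<Sum>i\<in>I. si i)) (ES t u) \<tau>"

definition tight_derivation :: "ctx \<Rightarrow> nat \<Rightarrow> nat \<Rightarrow> nat \<Rightarrow> trm \<Rightarrow> ty \<Rightarrow> bool" where
  "tight_derivation \<Gamma> m e s t \<sigma> \<longleftrightarrow> derivN \<Gamma> m e s t \<sigma> \<and> tight_context \<Gamma> \<and> tight_type \<sigma>"

lemma typing_context_pop: "typing_context \<Gamma> \<Longrightarrow> typing_context (ctx_pop \<Gamma>)"
proof -
  assume "typing_context \<Gamma>"
  moreover have "Suc ` ctx_dom (ctx_pop \<Gamma>) \<subseteq> ctx_dom \<Gamma>"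
    by (auto simp: ctx_dom_def ctx_pop_def)
  ultimately show ?thesis
    unfolding typing_context_def by (meson finite_imageD finite_subset inj_Suc)
qed

lemma typing_context_add:
  "typing_context \<Gamma> \<Longrightarrow> typing_context \<Delta> \<Longrightarrow> typing_context (ctx_add \<Gamma> \<Delta>)"
proof -
  have "ctx_dom (ctx_add \<Gamma> \<Delta>) = ctx_dom \<Gamma> \<union> ctx_dom \<Delta>"
    by (auto simp: ctx_dom_def ctx_add_def)
  then show "typing_context \<Gamma> \<Longrightarrow> typing_context \<Delta> \<Longrightarrow> ?thesis"
    by (simp add: typing_context_def)
qed

lemma typing_context_sum:
  assumes "finite I" "\<And>i. i \<in> I \<Longrightarrow> typing_context (\<Delta> i)"
  shows "typing_context (ctx_sum I \<Delta>)"
proof -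
  have "ctx_dom (ctx_sum I \<Delta>) \<subseteq> (\<Union>i\<in>I. ctx_dom (\<Delta> i))"
    by (auto simp: ctx_dom_def ctx_sum_def intro: ccontr elim: sum.not_neutral_contains_not_neutral)
  then show ?thesis
    using assms unfolding typing_context_def by (meson finite_UN_I finite_subset)
qed

lemma derivN_typing_context: "derivN \<Gamma> m e s t \<sigma> \<Longrightarrow> typing_context \<Gamma>"
proof (induction rule: derivN.induct)
  case (var_c x \<sigma>)
  have "ctx_dom (ctx_single x {#\<sigma>#}) = {x}"
    by (auto simp: ctx_dom_def ctx_single_def)
  then show ?case
    by (simp add: typing_context_def)
qed (auto intro: typing_context_pop typing_context_add typing_context_sum)

end

theory Submission
  imports Defs
begin

text \<open>
  The theorem follows by induction on the reduction from two facts: a normal form \<open>p\<close> has a tight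
  derivation with counters \<open>(0, 0, |p|\<^sub>n)\<close>, and undoing one reduction step preserves the context
  and the type of a derivation while increasing by one exactly the counter of the kind of the
  step.  The counters are exact because the hole of a CBN context is typed exactly once.  At a
  \<open>dB\<close> redex, the \<open>es_c\<close> rule for \<open>t[x\u]\<close> is replaced by \<open>abs_c\<close> followed by \<open>app_c\<close>; at an
  \<open>sn\<close> redex, a derivation of \<open>t{x:=u}\<close> is split into one of \<open>t\<close> and one of \<open>u\<close> for each type
  that \<open>x\<close> receives in \<open>t\<close>.
\<close>

subsection \<open>Derivations of multitypes\<close>

text \<open>Stands for the finite family of premises that \<open>app_c\<close> and
  \<open>es_c\<close> require of their argument. Without index sets, families can be joined without
  making indices disjoint, and induction adds one premise at a time.\<close>

inductive derivM :: "ctx \<Rightarrow> nat \<Rightarrow> nat \<Rightarrow> nat \<Rightarrow> trm \<Rightarrow> multitype \<Rightarrow> bool" where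
  derivM_empty: "derivM (\<lambda>_. {#}) 0 0 0 u {#}"
| derivM_add_mset: "derivN \<Gamma> m e s u \<sigma> \<Longrightarrow> derivM \<Delta> m' e' s' u M \<Longrightarrow>
    derivM (ctx_add \<Gamma> \<Delta>) (m + m') (e + e') (s + s') u (add_mset \<sigma> M)"

text \<open>
  As simplification rules, the next three equations also rewrite unapplied contexts into
  \<open>\<lambda>\<close>-abstractions, so they are mostly used at a fixed variable.
\<close>

lemma ctx_add_apply: "ctx_add \<Gamma> \<Delta> x = \<Gamma> x + \<Delta> x"
  by (simp add: ctx_add_def)

lemma ctx_pop_apply: "ctx_pop \<Gamma> x = \<Gamma> (Suc x)"
  by (simp add: ctx_pop_def)

lemma ctx_single_apply: "ctx_single x M y = (if y = x then M else {#})"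
  by (simp add: ctx_single_def)

lemma ctx_add_assoc: "ctx_add (ctx_add \<Gamma> \<Delta>) \<Theta> = ctx_add \<Gamma> (ctx_add \<Delta> \<Theta>)"
  by (simp add: ctx_add_def add.assoc)

lemma ctx_add_empty [simp]: "ctx_add (\<lambda>_. {#}) \<Delta> = \<Delta>" "ctx_add \<Gamma> (\<lambda>_. {#}) = \<Gamma>"
  by (simp_all add: ctx_add_def)

lemma derivM_family:
  assumes "finite I" "\<And>i. i \<in> I \<Longrightarrow> derivN (\<Delta> i) (mi i) (ei i) (si i) u (\<sigma> i)"
  shows "derivM (ctx_sum I \<Delta>) (\<Sum>i\<in>I. mi i) (\<Sum>i\<in>I. ei i) (\<Sum>i\<in>I. si i) u (family I \<sigma>)"
  using assms
proof (induction I rule: finite_induct)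
  case empty
  then show ?case
    by (simp add: ctx_sum_def family_def derivM_empty)
next
  case (insert i I)
  have "ctx_sum (insert i I) \<Delta> = ctx_add (\<Delta> i) (ctx_sum I \<Delta>)"
    using insert.hyps by (simp add: ctx_sum_def ctx_add_def)
  moreover have "family (insert i I) \<sigma> = add_mset (\<sigma> i) (family I \<sigma>)"
    using insert.hyps by (simp add: family_def)
  ultimately show ?case
    using insert by (simp add: derivM_add_mset)
qed

lemma derivM_familyE:
  assumes "derivM \<Gamma> m e s u M"
  obtains I \<sigma> \<Delta> mi ei si where "finite I" "M = family I \<sigma>" "\<Gamma> = ctx_sum I \<Delta>"
    "m = (\<Sum>i\<in>I. mi i)" "e = (\<Sum>i\<in>I. ei i)" "s = (\<Sum>i\<in>I. si i)"
    "\<And>i. i \<in> I \<Longrightarrow> derivN (\<Delta> i) (mi i) (ei i) (si i) u (\<sigma> i)"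
  using assms
proof (induction arbitrary: thesis rule: derivM.induct)
  case (derivM_empty u)
  show ?case
    by (rule derivM_empty[of "{}"]) (simp_all add: family_def ctx_sum_def)
next
  case (derivM_add_mset \<Gamma> m e s u \<tau> \<Theta> m' e' s' M)
  obtain I \<sigma> \<Delta> mi ei si where I: "finite I" "M = family I \<sigma>" "\<Theta> = ctx_sum I \<Delta>"
    "m' = (\<Sum>i\<in>I. mi i)" "e' = (\<Sum>i\<in>I. ei i)" "s' = (\<Sum>i\<in>I. si i)"
    "\<And>i. i \<in> I \<Longrightarrow> derivN (\<Delta> i) (mi i) (ei i) (si i) u (\<sigma> i)"
    using derivM_add_mset.IH by blast
  \<comment> \<open>The new premise needs an index outside \<open>I\<close>; one exists because
    \<open>I\<close> is finite.\<close>
  obtain k where k: "k \<notin> I"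
    using I(1) ex_new_if_finite infinite_UNIV_nat by blast
  have upd: "(if i = k then a else f i) = f i" if "i \<in> I" for i a and f :: "nat \<Rightarrow> 'b"
    using that k by auto
  have sum: "(\<Sum>i\<in>insert k I. (f(k := a)) i) = a + (\<Sum>i\<in>I. f i)" for f :: "nat \<Rightarrow> nat" and a
    using I(1) k by (simp add: upd cong: sum.cong)
  show ?case
  proof (rule derivM_add_mset.prems[of "insert k I" "\<sigma>(k := \<tau>)" "\<Delta>(k := \<Gamma>)"
        "mi(k := m)" "ei(k := e)" "si(k := s)"])
    show "add_mset \<tau> M = family (insert k I) (\<sigma>(k := \<tau>))"
      using I(1,2) k by (auto simp: family_def intro!: image_mset_cong)
    show "ctx_add \<Gamma> \<Theta> = ctx_sum (insert k I) (\<Delta>(k := \<Gamma>))"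
      using I(1,3) k by (auto simp: ctx_sum_def ctx_add_def fun_eq_iff upd cong: sum.cong)
    show "derivN ((\<Delta>(k := \<Gamma>)) i) ((mi(k := m)) i) ((ei(k := e)) i) ((si(k := s)) i) u ((\<sigma>(k := \<tau>)) i)"
      if "i \<in> insert k I" for i
      using that I(7) k derivM_add_mset.hyps by (cases "i = k") auto
  qed (simp_all only: sum I finite_insert)
qed

lemma derivM_add:
  assumes "derivM \<Gamma> m e s u M" "derivM \<Gamma>' m' e' s' u M'"
  shows "derivM (ctx_add \<Gamma> \<Gamma>') (m + m') (e + e') (s + s') u (M + M')"
  using assms
proof (induction rule: derivM.induct)
  case (derivM_add_mset \<Gamma> m e s u \<sigma> \<Delta> m' e' s' M)
  then show ?case
    using derivM.derivM_add_mset[OF derivM_add_mset.hyps(1) derivM_add_mset.IH]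
    by (simp add: ctx_add_assoc add.assoc)
qed simp

lemma derivM_single: "derivN \<Gamma> m e s u \<sigma> \<Longrightarrow> derivM \<Gamma> m e s u {#\<sigma>#}"
  using derivM_add_mset[OF _ derivM_empty] by force

section \<open>Typing rules and inversions with arguments typed by multitypes\<close>

lemma derivN_App:
  assumes "derivN \<Gamma> m e s t (Arrow M \<tau>)" "derivM \<Delta> m' e' s' u M"
  shows "derivN (ctx_add \<Gamma> \<Delta>) (1 + m + m') (1 + e + e') (s + s') (App t u) \<tau>"
  using assms(2) by (rule derivM_familyE) (use app_c assms(1) in blast)

lemma derivN_ES:
  assumes "derivN \<Gamma> m e s t \<tau>" "derivM \<Delta> m' e' s' u (\<Gamma> 0)"
  shows "derivN (ctx_add (ctx_pop \<Gamma>) \<Delta>) (m + m') (1 + e + e') (s + s') (ES t u) \<tau>"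
  using assms(2) by (rule derivM_familyE) (use es_c assms(1) in blast)

lemma derivN_AppE:
  assumes "derivN \<Gamma> m e s (App t u) \<tau>"
  obtains (persistent) s' where "s = s' + 1" "\<tau> = Tight TN" "derivN \<Gamma> m e s' t (Tight TN)"
  | (consuming) M \<Gamma>' m' e' s' \<Delta> m'' e'' s'' where
    "derivN \<Gamma>' m' e' s' t (Arrow M \<tau>)" "derivM \<Delta> m'' e'' s'' u M" "\<Gamma> = ctx_add \<Gamma>' \<Delta>"
    "m = 1 + m' + m''" "e = 1 + e' + e''" "s = s' + s''"
  using assms by cases (blast intro: derivM_family)+

lemma derivN_ESE:
  assumes "derivN \<Gamma> m e s (ES t u) \<tau>"
  obtains \<Gamma>' m' e' s' \<Delta> m'' e'' s'' where
    "derivN \<Gamma>' m' e' s' t \<tau>" "derivM \<Delta> m'' e'' s'' u (\<Gamma>' 0)" "\<Gamma> = ctx_add (ctx_pop \<Gamma>') \<Delta>"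
    "m = m' + m''" "e = 1 + e' + e''" "s = s' + s''"
  using assms
proof cases
  case (es_c I \<Gamma>' m' e' s' \<sigma> \<Delta> mi ei si)
  then show ?thesis
    by (intro that[OF es_c(6), of "ctx_sum I \<Delta>"]) (auto intro: derivM_family)
qed

lemma derivN_LamE:
  assumes "derivN \<Gamma> m e s (Lam t) \<sigma>"
  obtains (persistent) \<Gamma>' s' tt where "\<Gamma> = ctx_pop \<Gamma>'" "s = s' + 1" "\<sigma> = Tight TA"
    "derivN \<Gamma>' m e s' t (Tight tt)" "tight_multitype (\<Gamma>' 0)"
  | (consuming) \<Gamma>' \<tau> where "\<Gamma> = ctx_pop \<Gamma>'" "\<sigma> = Arrow (\<Gamma>' 0) \<tau>" "derivN \<Gamma>' m e s t \<tau>"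
  using assms by cases blast+

lemma derivN_VarE:
  assumes "derivN \<Gamma> m e s (Var x) \<sigma>"
  obtains "\<Gamma> = ctx_single x {#\<sigma>#}" "m = 0" "e = 0" "s = 0"
  using assms by cases blast

subsection \<open>Removing a variable from the scope\<close>

text \<open>Context counterpart of the index shift performed by \<open>subst\<close> at
  \<open>j\<close>; going below binders forces an arbitrary \<open>j\<close> instead of the index 0
  of \<open>ctx_pop\<close>.\<close>

definition ctx_del :: "nat \<Rightarrow> ctx \<Rightarrow> ctx" where
  "ctx_del j \<Gamma> = (\<lambda>x. if x < j then \<Gamma> x else \<Gamma> (Suc x))"

lemma ctx_del_0: "ctx_del 0 = ctx_pop"
  by (simp add: ctx_del_def ctx_pop_def fun_eq_iff)

lemma ctx_del_add: "ctx_del j (ctx_add \<Gamma> \<Delta>) = ctx_add (ctx_del j \<Gamma>) (ctx_del j \<Delta>)"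
  by (simp add: ctx_del_def ctx_add_def fun_eq_iff)

lemma ctx_pop_add: "ctx_pop (ctx_add \<Gamma> \<Delta>) = ctx_add (ctx_pop \<Gamma>) (ctx_pop \<Delta>)"
  by (simp add: ctx_pop_def ctx_add_def)

lemma ctx_pop_del_Suc: "ctx_pop (ctx_del (Suc j) \<Gamma>) = ctx_del j (ctx_pop \<Gamma>)"
  by (simp add: ctx_pop_def ctx_del_def fun_eq_iff)

lemma ctx_del_Suc_0 [simp]: "ctx_del (Suc j) \<Gamma> 0 = \<Gamma> 0"
  by (simp add: ctx_del_def)

lemma ctx_del_empty [simp]: "ctx_del j (\<lambda>_. {#}) = (\<lambda>_. {#})"
  by (simp add: ctx_del_def)

lemma lift_Suc: "lift (Suc k) c t = lift k c (lift 1 c t)"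
  by (induction t arbitrary: c) auto

lemma lift_0: "lift 0 c t = t"
  by (induction t arbitrary: c) auto

text \<open>The first assumption has the shape of the induction hypothesis for an argument in
  \<open>derivN_strengthen\<close>, so the induction there can stay on terms alone.\<close>

lemma derivM_strengthen_if:
  assumes "\<And>\<Gamma> m e s \<sigma>. derivN \<Gamma> m e s (lift 1 c t) \<sigma> \<Longrightarrow>
      \<Gamma> c = {#} \<and> derivN (ctx_del c \<Gamma>) m e s t \<sigma>"
    and "derivM \<Gamma> m e s (lift 1 c t) M"
  shows "\<Gamma> c = {#} \<and> derivM (ctx_del c \<Gamma>) m e s t M"
  using assms(2)
  by (induction \<Gamma> m e s "lift 1 c t" M rule: derivM.induct)
    (use assms(1) in \<open>auto simp: ctx_del_add ctx_add_apply[of _ _ c] intro: derivM.intros\<close>)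

text \<open>The system is relevant: \<open>var_c\<close> assigns types only to its own variable and
  no rule weakens. Index \<open>c\<close> does not occur in \<open>lift 1 c t\<close>, so it
  receives no type.\<close>

lemma derivN_strengthen:
  "derivN \<Gamma> m e s (lift 1 c t) \<sigma> \<Longrightarrow> \<Gamma> c = {#} \<and> derivN (ctx_del c \<Gamma>) m e s t \<sigma>"
proof (induction t arbitrary: c \<Gamma> m e s \<sigma>)
  case (Var x)
  have "ctx_del c (ctx_single x M) = ctx_single x M" if "x < c" for M
    using that by (auto simp: ctx_del_def ctx_single_def)
  moreover have "ctx_del c (ctx_single (Suc x) M) = ctx_single x M" if "\<not> x < c" for M
    using that by (auto simp: ctx_del_def ctx_single_def)
  ultimately show ?case
    using Var by (auto simp: ctx_single_apply[of _ _ c] intro: var_c elim!: derivN_VarE split: if_splits)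
next
  case (Lam t)
  from Lam.prems have "derivN \<Gamma> m e s (Lam (lift 1 (Suc c) t)) \<sigma>"
    by simp
  then show ?case
  proof (cases rule: derivN_LamE)
    case (persistent \<Gamma>' s' tt)
    then show ?thesis
      using Lam.IH[OF persistent(4)] abs_p[of "ctx_del (Suc c) \<Gamma>'" m e s' t tt]
      by (simp add: ctx_pop_del_Suc ctx_pop_apply[of _ c])
  next
    case (consuming \<Gamma>' \<tau>)
    then show ?thesis
      using Lam.IH[OF consuming(3)] abs_c[of "ctx_del (Suc c) \<Gamma>'" m e s t \<tau>]
      by (simp add: ctx_pop_del_Suc ctx_pop_apply[of _ c])
  qed
next
  case (App t u)
  from App.prems have "derivN \<Gamma> m e s (App (lift 1 c t) (lift 1 c u)) \<sigma>"
    by simp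
  then show ?case
  proof (cases rule: derivN_AppE)
    case persistent
    then show ?thesis
      using App.IH(1) app_p by blast
  next
    case (consuming M \<Gamma>' m' e' s' \<Delta> m'' e'' s'')
    then show ?thesis
      using App.IH(1)[OF consuming(1)] derivM_strengthen_if[OF App.IH(2) consuming(2)]
      by (auto simp: ctx_del_add ctx_add_apply[of _ _ c] derivN_App[simplified])
  qed
next
  case (ES t u)
  from ES.prems have "derivN \<Gamma> m e s (ES (lift 1 (Suc c) t) (lift 1 c u)) \<sigma>"
    by simp
  then show ?case
  proof (cases rule: derivN_ESE)
    case (1 \<Gamma>' m' e' s' \<Delta> m'' e'' s'')
    have "derivN (ctx_del (Suc c) \<Gamma>') m' e' s' t \<sigma>" "\<Gamma>' (Suc c) = {#}"
      using ES.IH(1)[OF 1(1)] by auto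
    \<comment> \<open>Deleting index \<open>Suc c\<close> leaves index 0 alone, so the multitype
      demanded of the argument is unchanged.\<close>
    moreover have "derivM (ctx_del c \<Delta>) m'' e'' s'' u (ctx_del (Suc c) \<Gamma>' 0)" "\<Delta> c = {#}"
      using derivM_strengthen_if[OF ES.IH(2) 1(2)] by auto
    ultimately show ?thesis
      using 1(3-) derivN_ES[of "ctx_del (Suc c) \<Gamma>'" m' e' s' t \<sigma> "ctx_del c \<Delta>" m'' e'' s'' u]
      by (simp add: ctx_del_add ctx_pop_del_Suc ctx_add_apply[of _ _ c] ctx_pop_apply[of _ c])
  qed
qed

lemma derivM_strengthen:
  assumes "derivM \<Delta> m e s (lift 1 0 u) M"
  shows "\<Delta> 0 = {#}" "derivM (ctx_pop \<Delta>) m e s u M"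
  using derivM_strengthen_if[OF derivN_strengthen assms] by (auto simp: ctx_del_0)

subsection \<open>Subject expansion\<close>

text \<open>
  Parametrising over the judgement \<open>D\<close> lets the same decomposition lemmas serve terms, multitypes
  and bodies of binders.
\<close>

definition splits ::
  "(ctx \<Rightarrow> nat \<Rightarrow> nat \<Rightarrow> nat \<Rightarrow> bool) \<Rightarrow> nat \<Rightarrow> trm \<Rightarrow> ctx \<Rightarrow> nat \<Rightarrow> nat \<Rightarrow> nat \<Rightarrow> bool" where
  "splits D j u \<Gamma> m e s \<longleftrightarrow> (\<exists>\<Theta> m' e' s' \<Delta> m'' e'' s''.
     D \<Theta> m' e' s' \<and> derivM \<Delta> m'' e'' s'' u (\<Theta> j) \<and>
     \<Gamma> = ctx_add (ctx_del j \<Theta>) \<Delta> \<and> m = m' + m'' \<and> e = e' + e'' \<and> s = s' + s'')"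

section \<open>Antisubstitution: splitting a derivation of a substituted term\<close>

lemma splitsI:
  assumes "D \<Theta> m' e' s'" "derivM \<Delta> m'' e'' s'' u (\<Theta> j)" "\<Gamma> = ctx_add (ctx_del j \<Theta>) \<Delta>"
    "m = m' + m''" "e = e' + e''" "s = s' + s''"
  shows "splits D j u \<Gamma> m e s"
  using assms unfolding splits_def by blast

lemma splits_shift:
  assumes "splits D j u \<Gamma> m e s" "\<And>\<Theta> m e s. D \<Theta> m e s \<Longrightarrow> D' \<Theta> (a + m) (b + e) (c + s)"
  shows "splits D' j u \<Gamma> (a + m) (b + e) (c + s)"
proof -
  obtain \<Theta> m' e' s' \<Delta> m'' e'' s'' where *: "D \<Theta> m' e' s'" "derivM \<Delta> m'' e'' s'' u (\<Theta> j)"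
    "\<Gamma> = ctx_add (ctx_del j \<Theta>) \<Delta>" "m = m' + m''" "e = e' + e''" "s = s' + s''"
    using assms(1) unfolding splits_def by blast
  show ?thesis
    by (rule splitsI[where D = D', OF assms(2)[OF *(1)] *(2,3)]) (use * in simp_all)
qed

text \<open>Covers every binary construction: the offsets \<open>a\<close> and \<open>b\<close> are
  both 1 for \<open>app_c\<close>, 0 and 1 for \<open>es_c\<close>, and both 0 for adding a premise
  to \<open>derivM\<close>.\<close>

lemma splits_add:
  assumes "splits D\<^sub>1 j u \<Gamma>\<^sub>1 m\<^sub>1 e\<^sub>1 s\<^sub>1" "splits D\<^sub>2 j u \<Gamma>\<^sub>2 m\<^sub>2 e\<^sub>2 s\<^sub>2"
    and "\<And>\<Theta>\<^sub>1 m\<^sub>1 e\<^sub>1 s\<^sub>1 \<Theta>\<^sub>2 m\<^sub>2 e\<^sub>2 s\<^sub>2. D\<^sub>1 \<Theta>\<^sub>1 m\<^sub>1 e\<^sub>1 s\<^sub>1 \<Longrightarrow> D\<^sub>2 \<Theta>\<^sub>2 m\<^sub>2 e\<^sub>2 s\<^sub>2 \<Longrightarrow>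
      D (ctx_add \<Theta>\<^sub>1 \<Theta>\<^sub>2) (a + m\<^sub>1 + m\<^sub>2) (b + e\<^sub>1 + e\<^sub>2) (s\<^sub>1 + s\<^sub>2)"
  shows "splits D j u (ctx_add \<Gamma>\<^sub>1 \<Gamma>\<^sub>2) (a + m\<^sub>1 + m\<^sub>2) (b + e\<^sub>1 + e\<^sub>2) (s\<^sub>1 + s\<^sub>2)"
proof -
  obtain \<Theta>\<^sub>1 m\<^sub>1' e\<^sub>1' s\<^sub>1' \<Delta>\<^sub>1 m\<^sub>1'' e\<^sub>1'' s\<^sub>1'' where 1: "D\<^sub>1 \<Theta>\<^sub>1 m\<^sub>1' e\<^sub>1' s\<^sub>1'"
    "derivM \<Delta>\<^sub>1 m\<^sub>1'' e\<^sub>1'' s\<^sub>1'' u (\<Theta>\<^sub>1 j)" "\<Gamma>\<^sub>1 = ctx_add (ctx_del j \<Theta>\<^sub>1) \<Delta>\<^sub>1"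
    "m\<^sub>1 = m\<^sub>1' + m\<^sub>1''" "e\<^sub>1 = e\<^sub>1' + e\<^sub>1''" "s\<^sub>1 = s\<^sub>1' + s\<^sub>1''"
    using assms(1) unfolding splits_def by blast
  obtain \<Theta>\<^sub>2 m\<^sub>2' e\<^sub>2' s\<^sub>2' \<Delta>\<^sub>2 m\<^sub>2'' e\<^sub>2'' s\<^sub>2'' where 2: "D\<^sub>2 \<Theta>\<^sub>2 m\<^sub>2' e\<^sub>2' s\<^sub>2'"
    "derivM \<Delta>\<^sub>2 m\<^sub>2'' e\<^sub>2'' s\<^sub>2'' u (\<Theta>\<^sub>2 j)" "\<Gamma>\<^sub>2 = ctx_add (ctx_del j \<Theta>\<^sub>2) \<Delta>\<^sub>2"
    "m\<^sub>2 = m\<^sub>2' + m\<^sub>2''" "e\<^sub>2 = e\<^sub>2' + e\<^sub>2''" "s\<^sub>2 = s\<^sub>2' + s\<^sub>2''"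
    using assms(2) unfolding splits_def by blast
  show ?thesis
  proof (rule splitsI[where D = D, OF assms(3)[OF 1(1) 2(1)]])
    show "derivM (ctx_add \<Delta>\<^sub>1 \<Delta>\<^sub>2) (m\<^sub>1'' + m\<^sub>2'') (e\<^sub>1'' + e\<^sub>2'') (s\<^sub>1'' + s\<^sub>2'') u (ctx_add \<Theta>\<^sub>1 \<Theta>\<^sub>2 j)"
      using derivM_add[OF 1(2) 2(2)] by (simp add: ctx_add_apply)
    show "ctx_add \<Gamma>\<^sub>1 \<Gamma>\<^sub>2 = ctx_add (ctx_del j (ctx_add \<Theta>\<^sub>1 \<Theta>\<^sub>2)) (ctx_add \<Delta>\<^sub>1 \<Delta>\<^sub>2)"
      using 1(3) 2(3) by (simp add: ctx_add_def ctx_del_def fun_eq_iff)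
  qed (use 1 2 in simp_all)
qed

text \<open>Leaves a binder. The lifted \<open>u\<close> gives no type to index 0, so all of
  \<open>\<Gamma> 0\<close> comes from the body. This equality is kept because
  \<open>\<Gamma> 0\<close> fixes the arrow type in \<open>abs_c\<close>, the side condition of
  \<open>abs_p\<close> and the argument types in \<open>es_c\<close>.\<close>

lemma splits_pop:
  assumes "splits D (Suc j) (lift 1 0 u) \<Gamma> m e s"
  shows "splits (\<lambda>\<Theta> m e s. \<exists>\<Theta>'. D \<Theta>' m e s \<and> \<Theta> = ctx_pop \<Theta>' \<and> \<Theta>' 0 = \<Gamma> 0) j u (ctx_pop \<Gamma>) m e s"
proof -
  obtain \<Theta> m' e' s' \<Delta> m'' e'' s'' where *: "D \<Theta> m' e' s'"
    "derivM \<Delta> m'' e'' s'' (lift 1 0 u) (\<Theta> (Suc j))" "\<Gamma> = ctx_add (ctx_del (Suc j) \<Theta>) \<Delta>"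
    "m = m' + m''" "e = e' + e''" "s = s' + s''"
    using assms unfolding splits_def by blast
  show ?thesis
  proof (rule splitsI[where \<Theta> = "ctx_pop \<Theta>" and \<Delta> = "ctx_pop \<Delta>"])
    show "\<exists>\<Theta>'. D \<Theta>' m' e' s' \<and> ctx_pop \<Theta> = ctx_pop \<Theta>' \<and> \<Theta>' 0 = \<Gamma> 0"
      using * derivM_strengthen(1)[OF *(2)] by (auto simp: ctx_add_apply)
    show "derivM (ctx_pop \<Delta>) m'' e'' s'' u (ctx_pop \<Theta> j)"
      using derivM_strengthen(2)[OF *(2)] by (simp add: ctx_pop_apply)
  qed (simp_all add: * ctx_pop_add ctx_pop_del_Suc)
qed

lemma antisubst_derivM_if:
  assumes "\<And>\<Gamma> m e s \<sigma>. derivN \<Gamma> m e s t' \<sigma> \<Longrightarrow> splits (\<lambda>\<Theta> m e s. derivN \<Theta> m e s t \<sigma>) j u \<Gamma> m e s"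
    and "derivM \<Gamma> m e s t' M"
  shows "splits (\<lambda>\<Theta> m e s. derivM \<Theta> m e s t M) j u \<Gamma> m e s"
  using assms(2,1)
proof (induction rule: derivM.induct)
  case (derivM_empty t')
  show ?case
    by (rule splitsI[where \<Theta> = "\<lambda>_. {#}"]) (rule derivM.derivM_empty | simp)+
next
  case (derivM_add_mset \<Gamma> m e s t' \<sigma> \<Delta> m' e' s' M)
  show ?case
    using splits_add[where a = 0 and b = 0, OF derivM_add_mset.prems[OF derivM_add_mset.hyps(1)]
        derivM_add_mset.IH[OF derivM_add_mset.prems]]
    by (simp add: derivM.derivM_add_mset)
qed

text \<open>Each typed copy of \<open>u\<close> is replaced by an axiom for \<open>j\<close>, and
  the removed derivations are collected in a \<open>derivM\<close>. Axioms have zero counters, so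
  the totals are preserved.\<close>

lemma antisubst:
  "derivN \<Gamma> m e s (subst t j u) \<sigma> \<Longrightarrow> splits (\<lambda>\<Theta> m e s. derivN \<Theta> m e s t \<sigma>) j u \<Gamma> m e s"
proof (induction t arbitrary: j u \<Gamma> m e s \<sigma>)
  case (Var x)
  show ?case
  proof (cases "x = j")
    case True
    \<comment> \<open>The whole derivation is one copy of \<open>u\<close>; the axiom left in its
      place contributes nothing to the context once \<open>j\<close> is deleted.\<close>
    have "ctx_del j (ctx_single j M) = (\<lambda>_. {#})" for M
      by (auto simp: ctx_del_def ctx_single_def)
    then show ?thesis
      using True Var derivM_single[of \<Gamma> m e s u \<sigma>]
      by (intro splitsI[where \<Theta> = "ctx_single x {#\<sigma>#}" and \<Delta> = \<Gamma>])
        (auto simp: var_c ctx_single_apply[of _ _ j])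
  next
    case False
    then have "derivN \<Gamma> m e s (Var (if x < j then x else x - 1)) \<sigma>"
      using Var by (simp split: if_splits)
    then show ?thesis
    proof (cases rule: derivN_VarE)
      case 1
      let ?y = "if x < j then x else x - 1"
      have "ctx_del j (ctx_single x {#\<sigma>#}) = ctx_single ?y {#\<sigma>#}"
        using False by (auto simp: ctx_single_def ctx_del_def fun_eq_iff)
      then show ?thesis
        using False 1 by (intro splitsI[where \<Theta> = "ctx_single x {#\<sigma>#}" and \<Delta> = "\<lambda>_. {#}"])
          (auto simp: var_c ctx_single_apply[of _ _ j] derivM_empty)
    qed
  qed
next
  case (Lam t)
  from Lam.prems have "derivN \<Gamma> m e s (Lam (subst t (Suc j) (lift 1 0 u))) \<sigma>"
    by simp
  then show ?case
  proof (cases rule: derivN_LamE)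
    case (persistent \<Gamma>' s' tt)
    then show ?thesis
      \<comment> \<open>The offset \<open>c = 1\<close> is the increment of the size counter in
        \<open>abs_p\<close>.\<close>
      using splits_shift[where a = 0 and b = 0 and c = 1, OF splits_pop[OF Lam.IH[OF persistent(4)]],
          of "\<lambda>\<Theta> m e s. derivN \<Theta> m e s (Lam t) \<sigma>"] abs_p[of _ _ _ _ t tt]
      by fastforce
  next
    case (consuming \<Gamma>' \<tau>)
    then show ?thesis
      using splits_shift[where a = 0 and b = 0 and c = 0, OF splits_pop[OF Lam.IH[OF consuming(3)]],
          of "\<lambda>\<Theta> m e s. derivN \<Theta> m e s (Lam t) \<sigma>"] abs_c[of _ _ _ _ t \<tau>]
      by fastforce
  qed
next
  case (App t r)
  from App.prems have "derivN \<Gamma> m e s (App (subst t j u) (subst r j u)) \<sigma>"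
    by simp
  then show ?case
  proof (cases rule: derivN_AppE)
    case (persistent s')
    then show ?thesis
      using splits_shift[where a = 0 and b = 0 and c = 1, OF App.IH(1)[OF persistent(3)],
          of "\<lambda>\<Theta> m e s. derivN \<Theta> m e s (App t r) \<sigma>"] app_p[of _ _ _ _ t r]
      by simp
  next
    case (consuming M \<Gamma>' m' e' s' \<Delta> m'' e'' s'')
    show ?thesis
      unfolding consuming(3-)
      by (rule splits_add[OF App.IH(1)[OF consuming(1)] antisubst_derivM_if[OF App.IH(2) consuming(2)]])
        (assumption | rule derivN_App)+
  qed
next
  case (ES t r)
  from ES.prems have "derivN \<Gamma> m e s (ES (subst t (Suc j) (lift 1 0 u)) (subst r j u)) \<sigma>"
    by simp
  then show ?case
  proof (cases rule: derivN_ESE)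
    case (1 \<Gamma>' m' e' s' \<Delta> m'' e'' s'')
    show ?thesis
      unfolding 1(3-)
      using splits_add[where a = 0 and b = 1, OF splits_pop[OF ES.IH(1)[OF 1(1)]]
          antisubst_derivM_if[OF ES.IH(2) 1(2)], of "\<lambda>\<Theta> m e s. derivN \<Theta> m e s (ES t r) \<sigma>"]
        derivN_ES[of _ _ _ _ t \<sigma> _ _ _ _ r]
      by fastforce
  qed
qed

section \<open>Expansion at the root of a redex\<close>

lemma expansion_sn:
  assumes "sn t t'" "derivN \<Gamma> m e s t' \<sigma>"
  shows "derivN \<Gamma> m (Suc e) s t \<sigma>"
  using assms(1)
proof cases
  case (sn r u)
  then have "splits (\<lambda>\<Theta> m e s. derivN \<Theta> m e s r \<sigma>) 0 u \<Gamma> m e s"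
    using antisubst assms(2) by simp
  then show ?thesis
    unfolding splits_def sn ctx_del_0 using derivN_ES by fastforce
qed

text \<open>Pulls the typing of \<open>u\<close> out through the binders of \<open>L\<close>,
  turning the innermost \<open>es_c\<close> into \<open>abs_c\<close>. The 1 in the equation for
  \<open>e\<close> is the increment of that \<open>es_c\<close>.\<close>

lemma derivN_lplug_ES:
  assumes "derivN \<Gamma> m e s (lplug L (ES t (lift (ldepth L) 0 u))) \<sigma>"
  obtains M \<Gamma>' m' e' s' \<Delta> m'' e'' s'' where
    "derivN \<Gamma>' m' e' s' (lplug L (Lam t)) (Arrow M \<sigma>)" "derivM \<Delta> m'' e'' s'' u M"
    "\<Gamma> = ctx_add \<Gamma>' \<Delta>" "m = m' + m''" "e = 1 + e' + e''" "s = s' + s''"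
  using assms
proof (induction L arbitrary: u \<Gamma> m e s thesis)
  case LHole
  from LHole.prems(2) have "derivN \<Gamma> m e s (ES t u) \<sigma>"
    by (simp add: lift_0)
  then show ?case
  proof (cases rule: derivN_ESE)
    case (1 \<Gamma>' m' e' s' \<Delta> m'' e'' s'')
    then show ?thesis
      using LHole.prems(1)[OF _ 1(2) 1(3-)] abs_c[OF 1(1)] by simp
  qed
next
  case (LES L r)
  from LES.prems(2)
  \<comment> \<open>Lifting by \<open>Suc (ldepth L)\<close> is split so that the induction
    hypothesis applies to \<open>lift 1 0 u\<close> under the outermost binder.\<close>
  have "derivN \<Gamma> m e s (ES (lplug L (ES t (lift (ldepth L) 0 (lift 1 0 u)))) r) \<sigma>"
    by (simp add: lift_Suc[of "ldepth L"])
  then show ?case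
  proof (cases rule: derivN_ESE)
    case (1 \<Gamma>' m' e' s' \<Delta> m'' e'' s'')
    obtain M \<Theta> m1 e1 s1 \<Xi> m2 e2 s2 where *:
      "derivN \<Theta> m1 e1 s1 (lplug L (Lam t)) (Arrow M \<sigma>)" "derivM \<Xi> m2 e2 s2 (lift 1 0 u) M"
      "\<Gamma>' = ctx_add \<Theta> \<Xi>" "m' = m1 + m2" "e' = 1 + e1 + e2" "s' = s1 + s2"
      using LES.IH[OF _ 1(1)] by blast
    \<comment> \<open>As \<open>\<Xi> 0\<close> is empty, \<open>\<Theta> 0 = \<Gamma>' 0\<close>,
      so the derivations of \<open>r\<close> still fit after the typing of \<open>u\<close> is
      removed.\<close>
    note u = derivM_strengthen[OF *(2)]
    have "derivN (ctx_add (ctx_pop \<Theta>) \<Delta>) (m1 + m'') (1 + e1 + e'') (s1 + s'')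
        (lplug (LES L r) (Lam t)) (Arrow M \<sigma>)"
      using derivN_ES[OF *(1)] 1(2) *(3) u(1) by (simp add: ctx_add_apply)
    then show ?thesis
      by (rule LES.prems(1)[OF _ u(2)])
        (use 1(3-) *(3-) in \<open>auto simp: ctx_add_def ctx_pop_def add_ac\<close>)
  qed
qed

text \<open>The new \<open>app_c\<close> adds 1 to both \<open>m\<close> and \<open>e\<close>; on
  \<open>e\<close> this only makes up for the lost \<open>es_c\<close>, so the net change is on
  \<open>m\<close>.\<close>

lemma expansion_dB:
  assumes "dB t t'" "derivN \<Gamma> m e s t' \<sigma>"
  shows "derivN \<Gamma> (Suc m) e s t \<sigma>"
  using assms(1)
proof cases
  case (dB L r u)
  show ?thesis
    using assms(2) unfolding dB by (rule derivN_lplug_ES) (use derivN_App in fastforce)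
qed

text \<open>CBN contexts never place the hole in an argument, so every rule typing the context has
  exactly one premise for the subterm with the hole, and the offsets \<open>a\<close> and
  \<open>b\<close> are added once.\<close>

lemma expansion_n_closure:
  assumes "n_closure R t t'" "derivN \<Gamma> m e s t' \<sigma>"
    and R: "\<And>t t' \<Gamma> m e s \<sigma>. R t t' \<Longrightarrow> derivN \<Gamma> m e s t' \<sigma> \<Longrightarrow> derivN \<Gamma> (a + m) (b + e) s t \<sigma>"
  shows "derivN \<Gamma> (a + m) (b + e) s t \<sigma>"
  using assms(1)
proof cases
  case (n_closure r r' N)
  have "derivN \<Gamma> m e s (nplug N r') \<sigma> \<Longrightarrow> derivN \<Gamma> (a + m) (b + e) s (nplug N r) \<sigma>"
  proof (induction N arbitrary: \<Gamma> m e s \<sigma>)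
    case NHole
    then show ?case
      using R n_closure(3) by simp
  next
    case (NApp N u)
    from NApp.prems have "derivN \<Gamma> m e s (App (nplug N r') u) \<sigma>"
      by simp
    then show ?case
    proof (cases rule: derivN_AppE)
      case persistent
      then show ?thesis
        using app_p NApp.IH by simp
    next
      case (consuming M \<Gamma>' m' e' s' \<Delta> m'' e'' s'')
      then show ?thesis
        using derivN_App[OF NApp.IH[OF consuming(1)] consuming(2)] by (simp add: add_ac)
    qed
  next
    case (NLam N)
    from NLam.prems have "derivN \<Gamma> m e s (Lam (nplug N r')) \<sigma>"
      by simp
    \<comment> \<open>Expansion keeps the context of the body, hence the side condition of
      \<open>abs_p\<close> and the arrow type of \<open>abs_c\<close>.\<close>
    then show ?case
      by (cases rule: derivN_LamE) (auto intro: NLam.IH abs_p[simplified] abs_c)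
  next
    case (NES N u)
    from NES.prems have "derivN \<Gamma> m e s (ES (nplug N r') u) \<sigma>"
      by simp
    then show ?case
    proof (cases rule: derivN_ESE)
      case (1 \<Gamma>' m' e' s' \<Delta> m'' e'' s'')
      then show ?thesis
        using derivN_ES[OF NES.IH[OF 1(1)] 1(2)] by (simp add: add_ac)
    qed
  qed
  then show ?thesis
    using assms(2) n_closure by simp
qed

lemma expansion:
  "n_reduces m e t p \<Longrightarrow> derivN \<Gamma> m' e' s p \<sigma> \<Longrightarrow> derivN \<Gamma> (m + m') (e + e') s t \<sigma>"
proof (induction rule: n_reduces.induct)
  case (n_mstep t t' m e p)
  then show ?case
    using expansion_n_closure[where a = 1 and b = 0] expansion_dB by fastforce
next
  case (n_estep t t' m e p)
  then show ?case
    using expansion_n_closure[where a = 0 and b = 1] expansion_sn by fastforce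
qed simp

subsection \<open>Normal forms\<close>

text \<open>Typing the head variable with \<open>TN\<close> lets \<open>app_p\<close> type every
  application; it leaves arguments untyped, just as \<open>nsize\<close> ignores them.\<close>

lemma ne_n_tight:
  "ne_n t \<Longrightarrow> \<exists>\<Gamma>. tight_context \<Gamma> \<and> derivN \<Gamma> 0 0 (nsize t) t (Tight TN)"
proof (induction rule: ne_n.induct)
  case (ne_var x)
  have "tight_context (ctx_single x {#Tight TN#})"
    by (simp add: tight_context_def tight_multitype_def tight_type_def ctx_single_def)
  then show ?case
    using var_c by fastforce
next
  case (ne_app t u)
  then show ?case
    using app_p by fastforce
qed

lemma no_n_tight: "no_n t \<Longrightarrow> \<exists>\<Gamma> \<sigma>. tight_derivation \<Gamma> 0 0 (nsize t) t \<sigma>"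
proof (induction rule: no_n.induct)
  case (no_lam t)
  then obtain \<Gamma> tt where "derivN \<Gamma> 0 0 (nsize t) t (Tight tt)" "tight_context \<Gamma>"
    by (auto simp: tight_derivation_def tight_type_def)
  \<comment> \<open>Tightness of the whole context supplies the side condition of
    \<open>abs_p\<close>, whose increment of \<open>s\<close> matches \<open>nsize\<close>.\<close>
  then have "tight_derivation (ctx_pop \<Gamma>) 0 0 (nsize (Lam t)) (Lam t) (Tight TA)"
    using abs_p by (auto simp: tight_derivation_def tight_type_def tight_context_def ctx_pop_def)
  then show ?case
    by blast
next
  case (no_ne t)
  then show ?case
    using ne_n_tight by (fastforce simp: tight_derivation_def tight_type_def)
qed

theorem theorem3p10:
  fixes t p :: trm and m e :: nat
  assumes "n_reduces m e t p" and "no_n p"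
  shows "\<exists>\<Gamma> \<sigma>. typing_context \<Gamma> \<and> tight_derivation \<Gamma> m e (nsize p) t \<sigma>"
proof -
  obtain \<Gamma> \<sigma> where "tight_derivation \<Gamma> 0 0 (nsize p) p \<sigma>"
    using no_n_tight assms(2) by blast
  then have "tight_derivation \<Gamma> m e (nsize p) t \<sigma>"
    using expansion[OF assms(1)] by (fastforce simp: tight_derivation_def)
  then show ?thesis
    using derivN_typing_context unfolding tight_derivation_def by blast
qed

end
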